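(* Let $\mathbb{F}$ be an infinite field of arbitrary characteristic. There is no non-trivial multihomogeneous polynomial identity for $\mathsf{A}_1^{(-,1)}$ of multidegree $(3,1)$. That is, if $f(x_1,x_2)\in\mathbb{F}\langle X\rangle$ is a linear combination of monomials of degree $3$ in $x_1$ and degree $1$ in $x_2$, and $f$ is a polynomial identity for $\mathsf{A}_1^{(-,1)}$, then $f=0$.
   Context: $\mathbb{F}\langle X\rangle$ is the free unital associative $\mathbb{F}$-algebra on $X=\{x_1,x_2,\dots\}$. The Weyl algebra $\mathsf{A}_1$ is the unital associative $\mathbb{F}$-algebra generated by $x,y$ with defining relation $yx=xy+1$, and $\mathsf{A}_1^{(-,1)}\subset\mathsf{A}_1$ is the $\mathbb{F}$-linear span of all elements $ay$ with $a\in\mathbb{F}[x]$. An element $f(x_1,\dots,x_m)\in\mathbb{F}\langle X\rangle$ is a polynomial identity for a subspace $\mathcal{V}$ of an associative algebra $\mathcal{A}$ if $f(a_1,\dots,a_m)=0$ in $\mathcal{A}$ for all $a_1,\dots,a_m\in\mathcal{V}$. The multidegree of a monomial $w$ in $x_1,\dots,x_m$ is $(\deg_{x_1}w,\dots,\deg_{x_m}w)$; an element is multihomogeneous of a given multidegree if it is a linear combination of monomials of that multidegree. *)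

theory Defs
  imports "HOL-Library.Poly_Mapping" "HOL-Computational_Algebra.Polynomial"
begin

section \<open>The free unital associative algebra\<close>

text \<open>
  The monoid of words is written additively, because the convolution product of
  \<open>Poly_Mapping\<close> expects the exponents to form an additive monoid; here \<open>+\<close> is
  concatenation and is not commutative.
\<close>

datatype 'a word = Word (letters: "'a list")

instantiation word :: (type) monoid_add
begin
definition zero_word :: "'a word" where "0 = Word []"
definition plus_word :: "'a word \<Rightarrow> 'a word \<Rightarrow> 'a word"
  where "u + v = Word (letters u @ letters v)"
instance
  by standard (auto simp: zero_word_def plus_word_def)
end

type_synonym ('a, 'f) free_algebra = "'a word \<Rightarrow>\<^sub>0 'f"

definition fa_const :: "'f \<Rightarrow> ('a, 'f::field) free_algebra"
  where "fa_const c = Poly_Mapping.single 0 c"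

definition fa_gen :: "'a \<Rightarrow> ('a, 'f::field) free_algebra"
  where "fa_gen g = Poly_Mapping.single (Word [g]) 1"

lemma fa_induct [case_names single add]:
  fixes p :: "('a, 'f::field) free_algebra"
  assumes single: "\<And>w c. P (Poly_Mapping.single w c)"
    and add: "\<And>p q. P p \<Longrightarrow> P q \<Longrightarrow> P (p + q)"
  shows "P p"
proof (induction p rule: update_induct)
  case const
  then show ?case using single[of 0 0] by simp
next
  case (update f a b)
  have "Poly_Mapping.update a b f = Poly_Mapping.single a b + f"
    using update(1)
    by (intro poly_mapping_eqI) (auto simp: lookup_update lookup_add lookup_single in_keys_iff)
  then show ?case using single[of a b] add update(3) by simp
qed

lemma fa_const_add: "fa_const (c + d) = fa_const c + fa_const d"
  by (simp add: fa_const_def Poly_Mapping.single_add)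

lemma fa_const_mult: "fa_const (c * d) = fa_const c * fa_const d"
  by (simp add: fa_const_def Poly_Mapping.mult_single)

lemma fa_const_1: "fa_const 1 = 1"
  by (simp add: fa_const_def)

lemma mult_fa_const_left:
  "Poly_Mapping.lookup (fa_const c * p) w = c * Poly_Mapping.lookup p w"
proof (induction p rule: fa_induct)
  case (single u v)
  then show ?case
    by (simp add: fa_const_def Poly_Mapping.mult_single lookup_single when_def)
next
  case (add p q)
  then show ?case by (simp add: distrib_left lookup_add)
qed

lemma mult_fa_const_right:
  "Poly_Mapping.lookup (p * fa_const c) w = c * Poly_Mapping.lookup p w"
proof (induction p rule: fa_induct)
  case (single u v)
  then show ?case
    by (simp add: fa_const_def Poly_Mapping.mult_single lookup_single when_def)
next
  case (add p q)
  then show ?case by (simp add: distrib_left distrib_right lookup_add)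
qed

lemma fa_const_central: "fa_const c * p = p * fa_const c"
  by (rule poly_mapping_eqI) (simp add: mult_fa_const_left mult_fa_const_right)


section \<open>Algebras given by generators and relations\<close>

definition two_sided_ideal :: "'r::ring_1 set \<Rightarrow> bool" where
  "two_sided_ideal I \<longleftrightarrow>
     0 \<in> I \<and> (\<forall>a\<in>I. \<forall>b\<in>I. a + b \<in> I) \<and> (\<forall>a\<in>I. \<forall>r. r * a \<in> I \<and> a * r \<in> I)"

definition ideal_generated :: "'r::ring_1 set \<Rightarrow> 'r set"
  where "ideal_generated R = \<Inter> {I. two_sided_ideal I \<and> R \<subseteq> I}"

lemma two_sided_ideal_generated: "two_sided_ideal (ideal_generated R)"
  unfolding ideal_generated_def two_sided_ideal_def by auto

lemma ideal_generated_base: "r \<in> R \<Longrightarrow> r \<in> ideal_generated R"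
  unfolding ideal_generated_def by auto

lemma
  shows ideal_generated_0: "0 \<in> ideal_generated R"
    and ideal_generated_add:
      "a \<in> ideal_generated R \<Longrightarrow> b \<in> ideal_generated R \<Longrightarrow> a + b \<in> ideal_generated R"
    and ideal_generated_mult_left: "a \<in> ideal_generated R \<Longrightarrow> r * a \<in> ideal_generated R"
    and ideal_generated_mult_right: "a \<in> ideal_generated R \<Longrightarrow> a * r \<in> ideal_generated R"
  using two_sided_ideal_generated[of R] by (auto simp: two_sided_ideal_def)

lemma ideal_generated_uminus: "a \<in> ideal_generated R \<Longrightarrow> - a \<in> ideal_generated R"
  using ideal_generated_mult_left[of a R "- 1"] by simp


section \<open>The Weyl algebra\<close>

datatype weyl_gen = Gx | Gy

definition weyl_ideal :: "(weyl_gen, 'f::field) free_algebra set" where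
  "weyl_ideal = ideal_generated {fa_gen Gy * fa_gen Gx - (fa_gen Gx * fa_gen Gy + 1)}"

definition weyl_rel ::
  "(weyl_gen, 'f::field) free_algebra \<Rightarrow> (weyl_gen, 'f) free_algebra \<Rightarrow> bool"
  where "weyl_rel p q \<longleftrightarrow> p - q \<in> weyl_ideal"

lemmas weyl_ideal_rules =
  ideal_generated_0[of "{fa_gen Gy * fa_gen Gx - (fa_gen Gx * fa_gen Gy + 1)}", folded weyl_ideal_def]
  ideal_generated_add[of _ "{fa_gen Gy * fa_gen Gx - (fa_gen Gx * fa_gen Gy + 1)}", folded weyl_ideal_def]
  ideal_generated_mult_left[of _ "{fa_gen Gy * fa_gen Gx - (fa_gen Gx * fa_gen Gy + 1)}", folded weyl_ideal_def]
  ideal_generated_mult_right[of _ "{fa_gen Gy * fa_gen Gx - (fa_gen Gx * fa_gen Gy + 1)}", folded weyl_ideal_def]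
  ideal_generated_uminus[of _ "{fa_gen Gy * fa_gen Gx - (fa_gen Gx * fa_gen Gy + 1)}", folded weyl_ideal_def]

lemma equivp_weyl_rel: "equivp weyl_rel"
proof (rule equivpI)
  show "reflp weyl_rel"
    by (auto intro!: reflpI simp: weyl_rel_def weyl_ideal_rules)
  show "symp weyl_rel"
    using weyl_ideal_rules(5) by (fastforce intro!: sympI simp: weyl_rel_def)
  show "transp weyl_rel"
    using weyl_ideal_rules(2) by (fastforce intro!: transpI simp: weyl_rel_def)
qed

lemma weyl_rel_reflI: "p = q \<Longrightarrow> weyl_rel p q"
  using equivp_reflp[OF equivp_weyl_rel] by simp

quotient_type (overloaded) 'f weyl = "(weyl_gen, 'f::field) free_algebra" / weyl_rel
  by (rule equivp_weyl_rel)

text \<open>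
  The ideal is proper in every characteristic: on polynomials, multiplication by the
  indeterminate and differentiation satisfy the defining relation.
\<close>

fun weyl_gen_act :: "weyl_gen \<Rightarrow> 'f::field poly \<Rightarrow> 'f poly" where
  "weyl_gen_act Gx q = pCons 0 q"
| "weyl_gen_act Gy q = pderiv q"

definition weyl_act :: "(weyl_gen, 'f::field) free_algebra \<Rightarrow> 'f poly \<Rightarrow> 'f poly" where
  "weyl_act p q =
     (\<Sum>w\<in>Poly_Mapping.keys p. smult (Poly_Mapping.lookup p w) (foldr weyl_gen_act (letters w) q))"

lemma weyl_act_single:
  "weyl_act (Poly_Mapping.single w c) q = smult c (foldr weyl_gen_act (letters w) q)"
  by (simp add: weyl_act_def)

lemma weyl_act_add: "weyl_act (p + p') q = weyl_act p q + weyl_act p' q"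
  unfolding weyl_act_def by (rule setsum_keys_plus_distrib) (auto simp: smult_add_left)

lemma weyl_act_diff: "weyl_act (p - p') q = weyl_act p q - weyl_act p' q"
  using weyl_act_add[of "p - p'" p' q] by simp

lemma weyl_gen_act_linear:
  "weyl_gen_act g (q + r) = weyl_gen_act g q + weyl_gen_act g r"
  "weyl_gen_act g (smult c q) = smult c (weyl_gen_act g q)"
  by (cases g; simp add: pderiv_add pderiv_smult)+

lemma weyl_word_act_linear:
  "foldr weyl_gen_act gs (q + r) = foldr weyl_gen_act gs q + foldr weyl_gen_act gs r"
  "foldr weyl_gen_act gs (smult c q) = smult c (foldr weyl_gen_act gs q)"
  by (induction gs) (simp_all add: weyl_gen_act_linear)

lemma weyl_act_right_add: "weyl_act p (q + r) = weyl_act p q + weyl_act p r"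
  by (simp add: weyl_act_def weyl_word_act_linear smult_add_right sum.distrib)

lemma weyl_act_mult: "weyl_act (p * p') q = weyl_act p (weyl_act p' q)"
proof (induction p rule: fa_induct)
  case (single w c)
  show ?case
  proof (induction p' rule: fa_induct)
    case (single u d)
    then show ?case
      by (simp add: Poly_Mapping.mult_single weyl_act_single plus_word_def weyl_word_act_linear)
  next
    case (add p' p'')
    then show ?case by (simp add: distrib_left weyl_act_add weyl_act_right_add)
  qed
next
  case (add p p'')
  then show ?case by (simp add: distrib_right weyl_act_add)
qed

lemma weyl_act_0: "weyl_act 0 q = 0" "weyl_act p 0 = 0"
proof -
  show "weyl_act 0 q = 0" by (simp add: weyl_act_def)
  show "weyl_act p 0 = 0" using weyl_act_right_add[of p 0 0] by (metis add_cancel_left_right)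
qed

lemma weyl_act_1: "weyl_act 1 q = q"
  using weyl_act_single[of 0 1 q] by (simp del: single_one add: zero_word_def)
    (simp add: single_one flip: zero_word_def)

lemma weyl_act_gen: "weyl_act (fa_gen g) q = weyl_gen_act g q"
  by (simp add: fa_gen_def weyl_act_single)

lemma weyl_act_ideal: "p \<in> weyl_ideal \<Longrightarrow> weyl_act p q = 0"
proof -
  let ?I = "{p. \<forall>q. weyl_act p q = 0}"
  have "two_sided_ideal ?I"
    by (auto simp: two_sided_ideal_def weyl_act_0 weyl_act_add weyl_act_mult)
  moreover have "fa_gen Gy * fa_gen Gx - (fa_gen Gx * fa_gen Gy + 1) \<in> ?I"
    by (simp add: weyl_act_diff weyl_act_add weyl_act_mult weyl_act_1 weyl_act_gen pderiv_pCons)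
  ultimately have "weyl_ideal \<subseteq> ?I"
    unfolding weyl_ideal_def ideal_generated_def by blast
  then show "p \<in> weyl_ideal \<Longrightarrow> weyl_act p q = 0" by blast
qed

lemma one_notin_weyl_ideal: "1 \<notin> weyl_ideal"
  using weyl_act_ideal[of 1 1] by (auto simp: weyl_act_1)

instantiation weyl :: (field) ring_1
begin

lift_definition zero_weyl :: "'a weyl" is 0 .
lift_definition one_weyl :: "'a weyl" is 1 .

lift_definition plus_weyl :: "'a weyl \<Rightarrow> 'a weyl \<Rightarrow> 'a weyl" is "(+)"
proof -
  fix p p' q q' :: "(weyl_gen, 'a) free_algebra"
  assume "weyl_rel p p'" "weyl_rel q q'"
  then have "(p - p') + (q - q') \<in> weyl_ideal"
    unfolding weyl_rel_def by (rule weyl_ideal_rules(2))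
  then show "weyl_rel (p + q) (p' + q')"
    unfolding weyl_rel_def by (simp add: algebra_simps)
qed

lift_definition uminus_weyl :: "'a weyl \<Rightarrow> 'a weyl" is uminus
  using weyl_ideal_rules(5) by (fastforce simp: weyl_rel_def)

lift_definition minus_weyl :: "'a weyl \<Rightarrow> 'a weyl \<Rightarrow> 'a weyl" is "(-)"
proof -
  fix p p' q q' :: "(weyl_gen, 'a) free_algebra"
  assume "weyl_rel p p'" "weyl_rel q q'"
  then have "(p - p') + - (q - q') \<in> weyl_ideal"
    unfolding weyl_rel_def by (intro weyl_ideal_rules(2) weyl_ideal_rules(5))
  then show "weyl_rel (p - q) (p' - q')"
    unfolding weyl_rel_def by (simp add: algebra_simps)
qed

lift_definition times_weyl :: "'a weyl \<Rightarrow> 'a weyl \<Rightarrow> 'a weyl" is "(*)"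
proof -
  fix p p' q q' :: "(weyl_gen, 'a) free_algebra"
  assume "weyl_rel p p'" "weyl_rel q q'"
  then have "(p - p') * q + p' * (q - q') \<in> weyl_ideal"
    unfolding weyl_rel_def by (intro weyl_ideal_rules(2-4))
  then show "weyl_rel (p * q) (p' * q')"
    unfolding weyl_rel_def by (simp add: algebra_simps)
qed

instance
proof
  show "(0 :: 'a weyl) \<noteq> 1"
  proof transfer
    show "\<not> weyl_rel (0 :: (weyl_gen, 'a) free_algebra) 1"
      using weyl_ideal_rules(5)[of "0 - 1 :: (weyl_gen, 'a) free_algebra"] one_notin_weyl_ideal
      unfolding weyl_rel_def by auto
  qed
qed (transfer; simp add: weyl_rel_reflI algebra_simps)+

end

lift_definition weyl_scale :: "'f::field \<Rightarrow> 'f weyl \<Rightarrow> 'f weyl" is "\<lambda>c p. fa_const c * p"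
  by (simp add: weyl_rel_def right_diff_distrib[symmetric] weyl_ideal_rules)

lift_definition weyl_x :: "'f::field weyl" is "fa_gen Gx" .
lift_definition weyl_y :: "'f::field weyl" is "fa_gen Gy" .

lemma weyl_relation: "weyl_y * weyl_x = weyl_x * weyl_y + 1"
  by transfer (simp add: weyl_rel_def weyl_ideal_def ideal_generated_base)

lemma
  shows weyl_scale_mult_left: "weyl_scale c a * b = weyl_scale c (a * b)"
    and weyl_scale_mult_right: "a * weyl_scale c b = weyl_scale c (a * b)"
proof -
  show "weyl_scale c a * b = weyl_scale c (a * b)"
    by transfer (rule weyl_rel_reflI, simp only: mult.assoc)
  show "a * weyl_scale c b = weyl_scale c (a * b)"
    by transfer (rule weyl_rel_reflI, metis mult.assoc fa_const_central)
qed

global_interpretation weyl: vector_space "weyl_scale :: 'f::field \<Rightarrow> 'f weyl \<Rightarrow> 'f weyl"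
proof
  fix c d :: 'f and a b :: "'f weyl"
  show "weyl_scale c (a + b) = weyl_scale c a + weyl_scale c b"
    by transfer (rule weyl_rel_reflI, simp only: distrib_left)
  show "weyl_scale (c + d) a = weyl_scale c a + weyl_scale d a"
    by transfer (rule weyl_rel_reflI, simp only: fa_const_add distrib_right)
  show "weyl_scale c (weyl_scale d a) = weyl_scale (c * d) a"
    by transfer (rule weyl_rel_reflI, simp only: fa_const_mult mult.assoc)
  show "weyl_scale 1 a = a"
    by transfer (rule weyl_rel_reflI, simp only: fa_const_1 mult_1_left)
qed

text \<open>The element of the Weyl algebra given by a polynomial in \<open>x\<close>.\<close>

definition weyl_of_poly :: "'f::field poly \<Rightarrow> 'f weyl"
  where "weyl_of_poly a = (\<Sum>i\<le>degree a. weyl_scale (coeff a i) (weyl_x ^ i))"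

definition weyl_minus_one :: "'f::field weyl set"
  where "weyl_minus_one = weyl.span {weyl_of_poly a * weyl_y | a. True}"


section \<open>Polynomial identities\<close>

text \<open>
  The variable \<open>x\<^sub>i\<close> is the generator with index \<open>i - 1\<close>, so that the indices range over
  all of \<open>nat\<close>. The argument \<open>sc\<close> is the scalar multiplication of the algebra.
\<close>

definition fa_eval ::
  "('f::field \<Rightarrow> 'a \<Rightarrow> 'a) \<Rightarrow> (nat \<Rightarrow> 'a::ring_1) \<Rightarrow> (nat, 'f) free_algebra \<Rightarrow> 'a" where
  "fa_eval sc s f =
     (\<Sum>w\<in>Poly_Mapping.keys f. sc (Poly_Mapping.lookup f w) (prod_list (map s (letters w))))"

text \<open>
  All variables are substituted, also those that do not occur in \<open>f\<close>; as a subspace is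
  not empty, this is the same as substituting for \<open>x\<^sub>1, \<dots>, x\<^sub>m\<close> only.
\<close>

definition polynomial_identity ::
  "('f::field \<Rightarrow> 'a \<Rightarrow> 'a) \<Rightarrow> 'a::ring_1 set \<Rightarrow> (nat, 'f) free_algebra \<Rightarrow> bool" where
  "polynomial_identity sc V f \<longleftrightarrow> (\<forall>s. (\<forall>i. s i \<in> V) \<longrightarrow> fa_eval sc s f = 0)"

text \<open>
  The list \<open>ds\<close> gives the degrees in \<open>x\<^sub>1, \<dots>, x\<^sub>m\<close>, where \<open>m\<close> is its length; no other
  variable occurs.
\<close>

definition has_multidegree :: "nat list \<Rightarrow> nat word \<Rightarrow> bool" where
  "has_multidegree ds w \<longleftrightarrow>
     (\<forall>i. count_list (letters w) i = (if i < length ds then ds ! i else 0))"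

definition multihomogeneous :: "nat list \<Rightarrow> (nat, 'f::field) free_algebra \<Rightarrow> bool" where
  "multihomogeneous ds f \<longleftrightarrow> (\<forall>w\<in>Poly_Mapping.keys f. has_multidegree ds w)"

end

(* Write c1, c2, c3, c4 for the coefficients of f at aaab, aaba, abaa, baaa. The Weyl algebra acts on
   F[t] by letting y act as the shift q(t) -> q(t+1) and x as q(t) -> t q(t-1); then xy acts as
   multiplication by t. Unlike the action by differentiation, this one satisfies no additional
   polynomial relation in xy in positive characteristic. Substituting a = xy, b = y and applying f
   to 1 gives c1 t^3 + c2 t^2 (t+1) + c3 t (t+1)^2 + c4 (t+1)^3, and these four polynomials are
   linearly independent over every field. *)
theory Submission
  imports Defs
begin

text \<open>The opposite shifts cancel in both products: \<open>yx\<close> multiplies by t+1 and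
  \<open>xy\<close> by t, so they differ by 1 in every characteristic.\<close>

fun shift_gen_act :: "weyl_gen \<Rightarrow> 'f::field poly \<Rightarrow> 'f poly" where
  "shift_gen_act Gx q = pCons 0 (q \<circ>\<^sub>p [:-1, 1:])"
| "shift_gen_act Gy q = q \<circ>\<^sub>p [:1, 1:]"

definition shift_act :: "(weyl_gen, 'f::field) free_algebra \<Rightarrow> 'f poly \<Rightarrow> 'f poly" where
  "shift_act p q =
     (\<Sum>w\<in>Poly_Mapping.keys p. smult (Poly_Mapping.lookup p w) (foldr shift_gen_act (letters w) q))"

lemma shift_act_single:
  "shift_act (Poly_Mapping.single w c) q = smult c (foldr shift_gen_act (letters w) q)"
  by (simp add: shift_act_def)

lemma shift_act_add: "shift_act (p + p') q = shift_act p q + shift_act p' q"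
  unfolding shift_act_def by (rule setsum_keys_plus_distrib) (auto simp: smult_add_left)

lemma shift_act_diff: "shift_act (p - p') q = shift_act p q - shift_act p' q"
  using shift_act_add[of "p - p'" p' q] by simp

lemma shift_gen_act_linear:
  "shift_gen_act g (q + r) = shift_gen_act g q + shift_gen_act g r"
  "shift_gen_act g (smult c q) = smult c (shift_gen_act g q)"
  by (cases g; simp add: pcompose_add pcompose_smult)+

lemma shift_word_act_linear:
  "foldr shift_gen_act gs (q + r) = foldr shift_gen_act gs q + foldr shift_gen_act gs r"
  "foldr shift_gen_act gs (smult c q) = smult c (foldr shift_gen_act gs q)"
  by (induction gs) (simp_all add: shift_gen_act_linear)

lemma shift_act_right_add: "shift_act p (q + r) = shift_act p q + shift_act p r"
  by (simp add: shift_act_def shift_word_act_linear smult_add_right sum.distrib)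

text \<open>\<open>foldr\<close> lets the last letter act first, so concatenation of words becomes
  composition of operators; linearity does the rest.\<close>

lemma shift_act_mult: "shift_act (p * p') q = shift_act p (shift_act p' q)"
proof (induction p rule: fa_induct)
  case (single w c)
  show ?case
  proof (induction p' rule: fa_induct)
    case (single u d)
    then show ?case
      by (simp add: Poly_Mapping.mult_single shift_act_single plus_word_def shift_word_act_linear)
  next
    case (add p' p'')
    then show ?case by (simp add: distrib_left shift_act_add shift_act_right_add)
  qed
next
  case (add p p'')
  then show ?case by (simp add: distrib_right shift_act_add)
qed

lemma shift_act_0: "shift_act 0 q = 0" "shift_act p 0 = 0"
proof -
  show "shift_act 0 q = 0" by (simp add: shift_act_def)
  show "shift_act p 0 = 0" using shift_act_right_add[of p 0 0] by (metis add_cancel_left_right)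
qed

lemma shift_act_const: "shift_act (fa_const c) q = smult c q"
  by (simp add: fa_const_def shift_act_single zero_word_def)

lemma shift_act_1: "shift_act 1 q = q"
  using shift_act_const[of 1 q] by (simp add: fa_const_1)

lemma shift_act_gen: "shift_act (fa_gen g) q = shift_gen_act g q"
  by (simp add: fa_gen_def shift_act_single)

lemma pcompose_shift_inverse:
  fixes q :: "'f::field poly"
  shows "(q \<circ>\<^sub>p [:1, 1:]) \<circ>\<^sub>p [:-1, 1:] = q" "(q \<circ>\<^sub>p [:-1, 1:]) \<circ>\<^sub>p [:1, 1:] = q"
  by (simp_all add: pcompose_assoc[symmetric] pcompose_pCons)

text \<open>The elements acting as zero form a two-sided ideal that contains the defining relator,
  hence the whole ideal it generates.\<close>

lemma shift_act_ideal:
  assumes "p \<in> weyl_ideal"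
  shows "shift_act p q = 0"
proof -
  let ?I = "{p. \<forall>q. shift_act p q = 0}"
  have "two_sided_ideal ?I"
    by (auto simp: two_sided_ideal_def shift_act_0 shift_act_add shift_act_mult)
  moreover have "fa_gen Gy * fa_gen Gx - (fa_gen Gx * fa_gen Gy + 1) \<in> ?I"
    by (simp add: shift_act_diff shift_act_add shift_act_mult shift_act_1 shift_act_gen
        pcompose_pCons pcompose_shift_inverse)
  ultimately have "weyl_ideal \<subseteq> ?I"
    unfolding weyl_ideal_def ideal_generated_def by blast
  then show ?thesis using assms by blast
qed

lift_definition weyl_shift_act :: "'f::field weyl \<Rightarrow> 'f poly \<Rightarrow> 'f poly" is shift_act
  using shift_act_ideal by (fastforce simp: weyl_rel_def shift_act_diff)

lemma weyl_shift_act_simps: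
  "weyl_shift_act 0 q = 0"
  "weyl_shift_act 1 q = q"
  "weyl_shift_act (a + b) q = weyl_shift_act a q + weyl_shift_act b q"
  "weyl_shift_act (a * b) q = weyl_shift_act a (weyl_shift_act b q)"
  "weyl_shift_act (weyl_scale c a) q = smult c (weyl_shift_act a q)"
  "weyl_shift_act weyl_x q = pCons 0 (q \<circ>\<^sub>p [:-1, 1:])"
  "weyl_shift_act weyl_y q = q \<circ>\<^sub>p [:1, 1:]"
  by (transfer; simp add: shift_act_0 shift_act_1 shift_act_add shift_act_mult shift_act_const
      shift_act_gen)+

lemma weyl_of_poly_mult_y_mem: "weyl_of_poly a * weyl_y \<in> weyl_minus_one"
  unfolding weyl_minus_one_def by (rule weyl.span_base) blast

lemma xy_mem_weyl_minus_one: "weyl_x * weyl_y \<in> weyl_minus_one"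
  \<comment> \<open>\<open>[:0, 1:]\<close> is the polynomial x itself.\<close>
  using weyl_of_poly_mult_y_mem[of "[:0, 1:]"] by (simp add: weyl_of_poly_def)

lemma y_mem_weyl_minus_one: "weyl_y \<in> weyl_minus_one"
  using weyl_of_poly_mult_y_mem[of 1] by (simp add: weyl_of_poly_def)

text \<open>Such a word is fixed by the position of its only letter 1: splitting there leaves m
  zeros before and n after, with m + n = 3.\<close>

lemma has_multidegree_3_1D:
  assumes "has_multidegree [3, 1] w"
  shows "w \<in> {Word [0,0,0,1], Word [0,0,1,0], Word [0,1,0,0], Word [1,0,0,0]}"
proof -
  obtain xs where w: "w = Word xs" by (cases w)
  have cnt: "count_list xs i = (if i < 2 then [3, 1] ! i else 0)" for i
    using assms by (simp add: has_multidegree_def w numeral_2_eq_2)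
  have c0: "count_list xs 0 = 3" and c1: "count_list xs 1 = 1"
    using cnt[of 0] cnt[of 1] by simp_all
  \<comment> \<open>Letters from index 2 on have count 0, the default value in
    \<open>has_multidegree\<close>.\<close>
  have "set xs \<subseteq> {0, 1}"
  proof
    fix i assume "i \<in> set xs"
    then have "count_list xs i \<noteq> 0" by (simp add: count_list_0_iff)
    then show "i \<in> {0, 1}" using cnt[of i] by (auto split: if_splits)
  qed
  moreover from c1 have "1 \<in> set xs" by (metis count_list_0_iff zero_neq_one)
  then obtain u v where uv: "xs = u @ 1 # v" by (auto dest: split_list)
  moreover have "1 \<notin> set u" "1 \<notin> set v"
    using c1 uv by (simp_all add: count_list_0_iff[symmetric])
  ultimately have "\<forall>i\<in>set u. i = 0" "\<forall>i\<in>set v. i = 0" by auto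
  then obtain m n where mn: "u = replicate m 0" "v = replicate n 0"
    by (metis replicate_length_same)
  have count_rep: "count_list (replicate k 0) (0::nat) = k" for k by (induction k) auto
  have "m + n = 3" using c0 by (simp add: uv mn count_rep)
  then have "m = 0 \<and> n = 3 \<or> m = 1 \<and> n = 2 \<or> m = 2 \<and> n = 1 \<or> m = 3 \<and> n = 0" by auto
  then show ?thesis by (auto simp: w uv mn numeral_eq_Suc)
qed

text \<open>Comparing coefficients from the constant term upwards gives a triangular system with
  unit diagonal, solvable without any division.\<close>

lemma cubic_products_independent:
  fixes a b c d :: "'f::field"
  assumes "smult a [:0,0,0,1:] + smult b [:0,0,1,1:] + smult c [:0,1,2,1:] + smult d [:1,3,3,1:] = 0"
  shows "a = 0" "b = 0" "c = 0" "d = 0"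
proof -
  have d: "d = 0" and c: "c + 3 * d = 0" and b: "b + 2 * c + 3 * d = 0" and a: "a + b + c + d = 0"
    using assms by (auto simp: algebra_simps)
  show "d = 0" by fact
  then show "c = 0" using c by simp
  then show "b = 0" using b d by simp
  then show "a = 0" using a \<open>c = 0\<close> d by simp
qed

theorem proposition3p2:
  fixes f :: "(nat, 'f::field) free_algebra"
  assumes "infinite (UNIV :: 'f set)"
    and "multihomogeneous [3, 1] f"
    and "polynomial_identity weyl_scale weyl_minus_one f"
  shows "f = 0"
proof -
  define c where "c = Poly_Mapping.lookup f"
  let ?W = "{Word [0,0,0,1], Word [0,0,1,0], Word [0,1,0,0], Word [1,0,0,0 :: nat]}"
  have keys: "Poly_Mapping.keys f \<subseteq> ?W"
    using assms(2) has_multidegree_3_1D unfolding multihomogeneous_def by blast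
  \<comment> \<open>Variables absent from \<open>f\<close> also receive \<open>weyl_y\<close>, so
    that every value lies in the subspace.\<close>
  define s :: "nat \<Rightarrow> 'f weyl" where "s i = (if i = 0 then weyl_x * weyl_y else weyl_y)" for i
  have "s i \<in> weyl_minus_one" for i
    by (simp add: s_def xy_mem_weyl_minus_one y_mem_weyl_minus_one)
  then have "fa_eval weyl_scale s f = 0"
    using assms(3) by (simp add: polynomial_identity_def)
  \<comment> \<open>Words of \<open>?W\<close> outside the support of \<open>f\<close> contribute
    zero.\<close>
  moreover have "fa_eval weyl_scale s f = (\<Sum>w\<in>?W. weyl_scale (c w) (prod_list (map s (letters w))))"
    unfolding fa_eval_def c_def using keys
    by (intro sum.mono_neutral_left) (auto simp: in_keys_iff)
  ultimately have
    "weyl_shift_act (\<Sum>w\<in>?W. weyl_scale (c w) (prod_list (map s (letters w)))) 1 = 0"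
    by (simp add: weyl_shift_act_simps)
  \<comment> \<open>Letters 0 to the right of the 1 act before the shift and give factors t+1; those
    to its left act after it and give factors t.\<close>
  then have "smult (c (Word [0,0,0,1])) [:0,0,0,1:] + smult (c (Word [0,0,1,0])) [:0,0,1,1:]
    + smult (c (Word [0,1,0,0])) [:0,1,2,1:] + smult (c (Word [1,0,0,0])) [:1,3,3,1:] = 0"
    by (auto simp: s_def weyl_shift_act_simps pcompose_pCons pcompose_1 algebra_simps)
  from cubic_products_independent[OF this] have "c w = 0" if "w \<in> ?W" for w
    using that by auto
  then show "f = 0"
    using keys by (intro poly_mapping_eqI) (auto simp: c_def in_keys_iff subset_iff)
qed

end
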